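(* For every $\alpha<1$ and $\vartheta\in\mathbb{R}$, $$N_{\alpha,\vartheta}=\{s\in\mathbb{R}: s=S(\alpha,\vartheta+\pi k)\text{ for some }k\in\mathbb{Z}\text{ such that }(\alpha,\vartheta+\pi k)\in W\}.$$
   Context: Let $\mathbb{C}_{3\pi/2}$ be $\mathbb{C}$ with the ray $\{-it:t\ge0\}$ removed, $\ln$ the branch of the logarithm on it with $\ln1=0$, $z^\rho=e^{\rho\ln z}$, and $\vartheta_\kappa=\pi\kappa/2$. Let $R$ be the unique holomorphic function on $\mathbb{C}\times\mathbb{C}\times\mathbb{C}_{3\pi/2}$ with $R(\kappa^2,\vartheta,z)=\frac1\kappa\left(z^{-\kappa/2}e^{i\pi\kappa/2}\cos(\vartheta-\vartheta_\kappa)-z^{\kappa/2}e^{-i\pi\kappa/2}\cos(\vartheta+\vartheta_\kappa)\right)$ for $\kappa\in\mathbb{C}\setminus\{0\}$ (then $R(0,\vartheta,z)=(\pi i-\ln z)\cos\vartheta+\pi\sin\vartheta$). Put $\Sigma_{\alpha,\vartheta}=\{E<0:R(\alpha,\vartheta,E)=0\}$ and $N_{\alpha,\vartheta}=\{s\in\mathbb{R}:-e^s\in\Sigma_{\alpha,\vartheta}\}$. Let $\omega$ be the $\pi$-periodic function on $\mathbb{R}$ with $\omega(\vartheta)=(1-2|\vartheta|/\pi)^2$ for $|\vartheta|\le\pi/2$. Let $Q_1=\{(\alpha,\vartheta)\in\mathbb{R}^2:0\le\alpha<\omega(\vartheta)\}$ and $Q_\infty=\{(\alpha,\vartheta)\in\mathbb{R}^2:\alpha<0\}$.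 Define the open sets $W_0=\{(\alpha,\vartheta)\in Q_1:\alpha>0,\ -\pi/2<\vartheta<\pi/2\}$ and $W=\{(\alpha,\vartheta)\in Q_1:-\pi/2<\vartheta<\pi/2\}\cup Q_\infty$. On $W_0$ define $S_0(\alpha,\vartheta)=\frac1{\sqrt\alpha}\ln\frac{\cos(\vartheta-\pi\sqrt\alpha/2)}{\cos(\vartheta+\pi\sqrt\alpha/2)}$ (the quotient is positive there). $S$ denotes the unique real-analytic function on $W$ such that $S|_{W_0}=S_0$ (such a function exists). *)

theory Defs
  imports "HOL-Analysis.Analysis"
begin

definition slit_plane :: "complex set" where
  "slit_plane = - {- \<i> * of_real t | t :: real. t \<ge> 0}"

text \<open>
  The branch of the logarithm with argument in \<open>(-\<pi>/2, 3\<pi>/2)\<close>: the rotation by \<open>-\<i>\<close> takes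
  the removed ray to the negative real axis, the cut of the principal branch.
\<close>

definition ln_slit :: "complex \<Rightarrow> complex" where
  "ln_slit z = Ln (- \<i> * z) + \<i> * of_real (pi / 2)"

definition pow_slit :: "complex \<Rightarrow> complex \<Rightarrow> complex" where
  "pow_slit z \<rho> = exp (\<rho> * ln_slit z)"

lemma slit_planeD:
  assumes "z \<in> slit_plane"
  shows "- \<i> * z \<notin> \<real>\<^sub>\<le>\<^sub>0" and "z \<noteq> 0"
proof -
  show *: "- \<i> * z \<notin> \<real>\<^sub>\<le>\<^sub>0"
  proof
    assume "- \<i> * z \<in> \<real>\<^sub>\<le>\<^sub>0"
    then have "Re z = 0" "Im z \<le> 0"
      by (auto simp: complex_nonpos_Reals_iff)
    then have "z = - \<i> * of_real (- Im z)" "- Im z \<ge> 0"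
      by (auto simp: complex_eq_iff)
    then show False
      using assms unfolding slit_plane_def by blast
  qed
  then show "z \<noteq> 0" by auto
qed

lemma ln_slit_1: "ln_slit 1 = 0"
  by (simp add: ln_slit_def)

lemma exp_ln_slit:
  assumes "z \<in> slit_plane"
  shows "exp (ln_slit z) = z"
proof -
  have "exp (\<i> * of_real (pi / 2)) = \<i>"
    by (simp only: exp_Euler cos_of_real sin_of_real) simp
  then have "exp (ln_slit z) = - \<i> * z * \<i>"
    using slit_planeD(2)[OF assms] by (simp add: ln_slit_def exp_add)
  also have "\<dots> = z"
    by (simp add: complex_eq_iff)
  finally show ?thesis .
qed

lemma holomorphic_ln_slit: "ln_slit holomorphic_on slit_plane"
  unfolding ln_slit_def using slit_planeD(1) by (intro holomorphic_intros) auto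

definition vartheta :: "complex \<Rightarrow> complex" where
  "vartheta \<kappa> = of_real pi * \<kappa> / 2"

text \<open>
  Holomorphy of a function of three complex variables on an open set: at every point the function
  is Frechet differentiable with a complex-linear derivative.
\<close>

definition holomorphic3_on :: "(complex \<times> complex \<times> complex \<Rightarrow> complex) \<Rightarrow>
    (complex \<times> complex \<times> complex) set \<Rightarrow> bool" where
  "holomorphic3_on f U \<longleftrightarrow>
     (\<forall>p\<in>U. \<exists>a b c. (f has_derivative (\<lambda>(x, y, z). a * x + b * y + c * z)) (at p))"

text \<open>
  The property characterising \<open>R\<close>. It determines \<open>R\<close> on \<open>\<complex> \<times> \<complex> \<times> slit_plane\<close> only; the values of
  the total HOL function elsewhere are irrelevant.
\<close>

definition is_R :: "(complex \<times> complex \<times> complex \<Rightarrow> complex) \<Rightarrow> bool" where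
  "is_R R \<longleftrightarrow>
     holomorphic3_on R (UNIV \<times> UNIV \<times> slit_plane) \<and>
     (\<forall>\<kappa> \<theta> z. \<kappa> \<noteq> 0 \<longrightarrow> z \<in> slit_plane \<longrightarrow>
        R (\<kappa>\<^sup>2, \<theta>, z) = 1 / \<kappa> *
          (pow_slit z (- \<kappa> / 2) * exp (\<i> * of_real pi * \<kappa> / 2) * cos (\<theta> - vartheta \<kappa>)
         - pow_slit z (\<kappa> / 2) * exp (- \<i> * of_real pi * \<kappa> / 2) * cos (\<theta> + vartheta \<kappa>)))"

definition Sigma_set :: "(complex \<times> complex \<times> complex \<Rightarrow> complex) \<Rightarrow> real \<Rightarrow> real \<Rightarrow> real set" where
  "Sigma_set R \<alpha> \<theta> =
     {E. E < 0 \<and> R (complex_of_real \<alpha>, complex_of_real \<theta>, complex_of_real E) = 0}"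

definition N_set :: "(complex \<times> complex \<times> complex \<Rightarrow> complex) \<Rightarrow> real \<Rightarrow> real \<Rightarrow> real set" where
  "N_set R \<alpha> \<theta> = {s. - exp s \<in> Sigma_set R \<alpha> \<theta>}"

text \<open>Subtracting the nearest multiple of \<open>\<pi>\<close> reduces the argument to \<open>[-\<pi>/2, \<pi>/2]\<close>.\<close>

definition omega :: "real \<Rightarrow> real" where
  "omega \<theta> = (1 - 2 * \<bar>\<theta> - pi * of_int (round (\<theta> / pi))\<bar> / pi)\<^sup>2"

lemma omega_periodic: "omega (\<theta> + pi) = omega \<theta>"
proof -
  have "round ((\<theta> + pi) / pi) = round (\<theta> / pi) + 1"
    by (simp add: round_def add_divide_distrib floor_eq_iff) linarith
  then show ?thesis
    by (simp add: omega_def algebra_simps)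
qed

lemma omega_eq:
  assumes "\<bar>\<theta>\<bar> \<le> pi / 2"
  shows "omega \<theta> = (1 - 2 * \<bar>\<theta>\<bar> / pi)\<^sup>2"
proof (cases "\<theta> = pi / 2")
  case True
  then have *: "\<theta> / pi = 1 / 2" by simp
  show ?thesis unfolding omega_def * by (simp add: True round_def)
next
  case False
  then have "- (1 / 2) \<le> \<theta> / pi" "\<theta> / pi < 1 / 2"
    using assms by (auto simp: field_simps abs_le_iff)
  moreover have "round t = 0" if "- (1 / 2) \<le> t" "t < 1 / 2" for t :: real
    using that by (simp add: round_def floor_eq_iff)
  ultimately have "round (\<theta> / pi) = 0" by blast
  then show ?thesis by (simp add: omega_def)
qed

definition Q1 :: "(real \<times> real) set" where
  "Q1 = {(\<alpha>, \<theta>). 0 \<le> \<alpha> \<and> \<alpha> < omega \<theta>}"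

definition Qinf :: "(real \<times> real) set" where
  "Qinf = {(\<alpha>, \<theta>). \<alpha> < 0}"

definition W0 :: "(real \<times> real) set" where
  "W0 = {(\<alpha>, \<theta>) \<in> Q1. \<alpha> > 0 \<and> - pi / 2 < \<theta> \<and> \<theta> < pi / 2}"

definition W :: "(real \<times> real) set" where
  "W = {(\<alpha>, \<theta>) \<in> Q1. - pi / 2 < \<theta> \<and> \<theta> < pi / 2} \<union> Qinf"

definition S0 :: "real \<times> real \<Rightarrow> real" where
  "S0 = (\<lambda>(\<alpha>, \<theta>). 1 / sqrt \<alpha> *
     ln (cos (\<theta> - pi * sqrt \<alpha> / 2) / cos (\<theta> + pi * sqrt \<alpha> / 2)))"

text \<open>
  Real analyticity in two variables on an open set: near each point of the set the function is
  the sum of an (absolutely) convergent double power series.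
\<close>

definition real_analytic2_on :: "(real \<times> real \<Rightarrow> real) \<Rightarrow> (real \<times> real) set \<Rightarrow> bool" where
  "real_analytic2_on f U \<longleftrightarrow>
     (\<forall>(a, b)\<in>U. \<exists>r>0. \<exists>c :: nat \<Rightarrow> nat \<Rightarrow> real. \<forall>x y. \<bar>x - a\<bar> < r \<longrightarrow> \<bar>y - b\<bar> < r \<longrightarrow>
        ((\<lambda>(m, n). c m n * (x - a) ^ m * (y - b) ^ n) has_sum f (x, y)) UNIV)"

definition is_S :: "(real \<times> real \<Rightarrow> real) \<Rightarrow> bool" where
  "is_S S \<longleftrightarrow> real_analytic2_on S W \<and> (\<forall>p\<in>W0. S p = S0 p)"

end

theory Submission
  imports Defs "HOL-Complex_Analysis.Conformal_Mappings"
begin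

text \<open>
  On the negative axis, \<open>R(\<kappa>\<^sup>2, \<theta>, -e\<^sup>s)\<close> is, for fixed \<open>\<kappa>\<close> and \<open>s\<close>, a linear form in \<open>(cos \<theta>, sin \<theta>)\<close>,
  so its zeros are \<open>\<pi>\<close>-periodic in \<open>\<theta>\<close>. For \<open>0 < \<alpha> < 1\<close> the zero equation is solved explicitly by \<open>S0\<close>.
  Since \<open>R(\<alpha>, \<theta>, -exp(S(\<alpha>, \<theta>)))\<close> is real analytic in each variable, the identity theorem carries its
  vanishing along \<open>\<alpha>\<close> to the strip \<open>\<bar>\<theta>\<bar> < \<pi>/2\<close> and then, for \<open>\<alpha> < 0\<close>, along \<open>\<theta>\<close> to all of \<open>W\<close>.
  Conversely, for \<open>\<alpha> < 0\<close> a solution \<open>s\<close> determines \<open>\<theta>\<close> modulo \<open>\<pi>\<close>, so it suffices that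
  \<open>S(\<alpha>, \<cdot>)\<close> is surjective: it is continuous and changes by a fixed nonzero amount
  over each period.
\<close>

section \<open>Real functions with local holomorphic extensions, and an identity theorem for
  them\<close>

definition locally_holomorphic_on :: "(real \<Rightarrow> complex) \<Rightarrow> real set \<Rightarrow> bool" where
  "locally_holomorphic_on f I \<longleftrightarrow>
     (\<forall>a\<in>I. \<exists>r>0. \<exists>g. g holomorphic_on ball (of_real a) r \<and>
        (\<forall>x. \<bar>x - a\<bar> < r \<longrightarrow> f x = g (of_real x)))"

lemma locally_holomorphic_imp_continuous:
  assumes "locally_holomorphic_on f I"
  shows "continuous_on I f"
  unfolding continuous_on_eq_continuous_within
proof
  fix a assume "a \<in> I"
  then obtain r g where r: "r > 0" and g: "g holomorphic_on ball (of_real a) r"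
    and eq: "\<And>x. \<bar>x - a\<bar> < r \<Longrightarrow> f x = g (of_real x)"
    using assms unfolding locally_holomorphic_on_def by blast
  have "continuous_on (ball a r) (\<lambda>x. g (of_real x))"
    by (rule continuous_on_compose2[OF holomorphic_on_imp_continuous_on[OF g]])
      (auto intro!: continuous_intros simp: dist_of_real)
  then have "continuous_on (ball a r) f"
    by (rule continuous_on_cong[THEN iffD1, rotated -1])
      (auto simp: eq dist_real_def abs_minus_commute)
  then show "continuous (at a within I) f"
    using r by (simp add: continuous_on_eq_continuous_at continuous_at_imp_continuous_within)
qed

text \<open>A clopen argument on the interior \<open>Z\<close> of the zero set. At a limit point
  \<open>a\<close> of \<open>Z\<close> in \<open>I\<close>, the local extension \<open>g\<close>
  vanishes on a real neighbourhood of some \<open>b\<close> in \<open>Z\<close> inside the disc.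
  These real points accumulate at \<open>b\<close>, so the complex identity theorem gives
  \<open>g = 0\<close> on the whole disc, and \<open>f\<close> vanishes near \<open>a\<close>.
  Working with extensions, not power series, also makes composition with \<open>R\<close>
  easy.\<close>

lemma locally_holomorphic_zero:
  assumes f: "locally_holomorphic_on f I" and I: "open I" "connected I"
    and U: "open U" "U \<noteq> {}" "U \<subseteq> I" "\<And>x. x \<in> U \<Longrightarrow> f x = 0"
    and x: "x \<in> I"
  shows "f x = 0"
proof -
  define Z where "Z = interior {x \<in> I. f x = 0}"
  have "Z \<subseteq> I"
    unfolding Z_def using interior_subset by blast
  have "U \<subseteq> Z"
    unfolding Z_def using U by (intro interior_maximal) auto
  have "a \<in> Z" if a: "a \<in> I" "a \<in> closure Z" for a
  proof -
    obtain r g where r: "r > 0" and g: "g holomorphic_on ball (of_real a) r"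
      and eq: "\<And>x. \<bar>x - a\<bar> < r \<Longrightarrow> f x = g (of_real x)"
      using f a unfolding locally_holomorphic_on_def by blast
    obtain e where e: "e > 0" "ball a e \<subseteq> I"
      using a I by (meson open_contains_ball)
    obtain b where b: "b \<in> Z" "dist b a < r"
      using a r closure_approachable by blast
    define V where "V = Z \<inter> ball a r"
    have V: "open V" "b \<in> V"
      using b by (auto simp: V_def Z_def dist_commute)
    have "b islimpt V"
      using V by (simp add: interior_limit_point interior_open)
    then have lim: "complex_of_real b islimpt of_real ` V"
      by (auto simp: islimpt_approachable dist_of_real)
    have "g w = 0" if "w \<in> ball (of_real a) r" for w
    proof (rule analytic_continuation[OF g _ _ _ _ lim _ that])
      show "complex_of_real ` V \<subseteq> ball (of_real a) r"
        by (auto simp: V_def dist_of_real)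
      show "complex_of_real b \<in> ball (of_real a) r"
        using b by (simp add: dist_of_real dist_commute)
      fix z assume "z \<in> complex_of_real ` V"
      then obtain y where y: "y \<in> V" "z = of_real y" by blast
      then have "f y = 0"
        using interior_subset unfolding V_def Z_def by blast
      with y show "g z = 0"
        using eq[of y] by (simp add: V_def dist_real_def abs_minus_commute)
    qed auto
    then have "f y = 0" if "y \<in> ball a r" for y
      using eq[of y] that by (simp add: dist_of_real dist_real_def abs_minus_commute)
    then have "ball a (min e r) \<subseteq> {x \<in> I. f x = 0}"
      using e by auto
    then show "a \<in> Z"
      unfolding Z_def mem_interior using e r by (meson min_less_iff_conj)
  qed
  then have "Z = closure Z \<inter> I"
    using \<open>Z \<subseteq> I\<close> closure_subset by blast
  then have "closedin (top_of_set I) Z"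
    by (metis closed_closure closedin_closed_Int inf_commute)
  moreover have "openin (top_of_set I) Z"
    using \<open>Z \<subseteq> I\<close> by (simp add: I Z_def openin_open_eq)
  ultimately have "Z = I"
    using I \<open>U \<subseteq> Z\<close> U unfolding connected_clopen by blast
  then show ?thesis
    using x interior_subset unfolding Z_def by blast
qed

text \<open>Convergence at a real point \<open>a + t\<close> with \<open>norm z < t < r\<close>
  forces convergence of the complex series at distance \<open>norm z\<close> from the centre. The
  same coefficients therefore define a holomorphic function on a disc of the same radius.\<close>

lemma power_series_extension:
  fixes f :: "real \<Rightarrow> real"
  assumes r: "r > 0" and sums: "\<And>x. \<bar>x - a\<bar> < r \<Longrightarrow> (\<lambda>n. c n * (x - a) ^ n) sums f x"
  shows "\<exists>g. g holomorphic_on ball (of_real a) r \<and>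
    (\<forall>x. \<bar>x - a\<bar> < r \<longrightarrow> complex_of_real (f x) = g (of_real x))"
proof (intro exI conjI allI impI)
  define g where "g = (\<lambda>z. \<Sum>n. complex_of_real (c n) * (z - of_real a) ^ n)"
  have summable: "summable (\<lambda>n. complex_of_real (c n) * z ^ n)" if "norm z < r" for z
  proof -
    obtain t where t: "norm z < t" "t < r"
      using dense[OF \<open>norm z < r\<close>] by blast
    have t0: "t > 0"
      using t(1) norm_ge_zero[of z] by linarith
    have "(\<lambda>n. c n * t ^ n) sums f (a + t)"
      using sums[of "a + t"] t t0 by simp
    from summable_of_real[OF sums_summable[OF this], where 'a = complex]
    have "summable (\<lambda>n. complex_of_real (c n) * of_real t ^ n)"
      by simp
    then show ?thesis
      by (rule powser_inside) (use t t0 in auto)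
  qed
  have "(g has_field_derivative
      (\<Sum>n. diffs (\<lambda>n. complex_of_real (c n)) n * (z - of_real a) ^ n)) (at z)"
    if z: "z \<in> ball (of_real a) r" for z
  proof -
    have "norm (z - of_real a) < r"
      using z by (simp add: dist_norm norm_minus_commute)
    then have D: "((\<lambda>z. \<Sum>n. complex_of_real (c n) * z ^ n) has_field_derivative
        (\<Sum>n. diffs (\<lambda>n. complex_of_real (c n)) n * (z - of_real a) ^ n)) (at (z - of_real a))"
      by (rule termdiffs_strong'[rotated]) (rule summable)
    have "((\<lambda>z. z - complex_of_real a) has_field_derivative 1) (at z)"
      by (auto intro!: derivative_eq_intros)
    from DERIV_chain2[where g = "\<lambda>z. z - complex_of_real a", OF D this] show ?thesis
      by (simp add: g_def)
  qed
  then show "g holomorphic_on ball (of_real a) r"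
    unfolding holomorphic_on_open[OF open_ball] by (intro ballI exI)
  fix x assume x: "\<bar>x - a\<bar> < r"
  have "(\<lambda>n. complex_of_real (c n) * (of_real x - of_real a) ^ n) sums of_real (f x)"
    using sums_of_real[OF sums[OF x], where 'a = complex] by simp
  then show "of_real (f x) = g (of_real x)"
    unfolding g_def by (rule sums_unique)
qed

text \<open>On the line through the centre every term with \<open>n > 0\<close> carries the factor
  \<open>(b - b) ^ n = 0\<close>, while \<open>0 ^ 0 = 1\<close> keeps the terms with
  \<open>n = 0\<close>. The double series thus collapses to a power series in one variable.\<close>

lemma real_analytic2_slice1:
  assumes "real_analytic2_on f U"
  shows "locally_holomorphic_on (\<lambda>x. of_real (f (x, b))) {x. (x, b) \<in> U}"
  unfolding locally_holomorphic_on_def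
proof
  fix a assume "a \<in> {x. (x, b) \<in> U}"
  then obtain r c where r: "r > 0"
    and c: "\<And>x y. \<bar>x - a\<bar> < r \<Longrightarrow> \<bar>y - b\<bar> < r \<Longrightarrow>
      ((\<lambda>(m, n). c m n * (x - a) ^ m * (y - b) ^ n) has_sum f (x, y)) (UNIV :: (nat \<times> nat) set)"
    using assms unfolding real_analytic2_on_def by blast
  have "(\<lambda>m. c m 0 * (x - a) ^ m) sums f (x, b)" if "\<bar>x - a\<bar> < r" for x
  proof -
    have "((\<lambda>(m, n). c m n * (x - a) ^ m * (b - b) ^ n) has_sum f (x, b)) UNIV"
      using c[of x b] that r by simp
    also have "?this \<longleftrightarrow> ((\<lambda>(m, n). c m n * (x - a) ^ m * (b - b) ^ n) has_sum f (x, b))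
        ((\<lambda>m. (m, 0)) ` UNIV)"
      by (rule has_sum_cong_neutral) (auto simp: image_iff power_0_left)
    also have "\<dots> \<longleftrightarrow> ((\<lambda>m. c m 0 * (x - a) ^ m) has_sum f (x, b)) UNIV"
      by (subst has_sum_reindex) (auto simp: inj_on_def o_def)
    finally show ?thesis
      by (rule has_sum_imp_sums)
  qed
  from power_series_extension[OF r this]
  show "\<exists>r>0. \<exists>g. g holomorphic_on ball (of_real a) r \<and>
      (\<forall>x. \<bar>x - a\<bar> < r \<longrightarrow> complex_of_real (f (x, b)) = g (of_real x))"
    using r by (intro exI[of _ r] conjI)
qed

lemma real_analytic2_slice2:
  assumes "real_analytic2_on f U"
  shows "locally_holomorphic_on (\<lambda>y. of_real (f (a, y))) {y. (a, y) \<in> U}"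
  unfolding locally_holomorphic_on_def
proof
  fix b assume "b \<in> {y. (a, y) \<in> U}"
  then obtain r c where r: "r > 0"
    and c: "\<And>x y. \<bar>x - a\<bar> < r \<Longrightarrow> \<bar>y - b\<bar> < r \<Longrightarrow>
      ((\<lambda>(m, n). c m n * (x - a) ^ m * (y - b) ^ n) has_sum f (x, y)) (UNIV :: (nat \<times> nat) set)"
    using assms unfolding real_analytic2_on_def by blast
  have "(\<lambda>n. c 0 n * (y - b) ^ n) sums f (a, y)" if "\<bar>y - b\<bar> < r" for y
  proof -
    have "((\<lambda>(m, n). c m n * (a - a) ^ m * (y - b) ^ n) has_sum f (a, y)) UNIV"
      using c[of a y] that r by simp
    also have "?this \<longleftrightarrow> ((\<lambda>(m, n). c m n * (a - a) ^ m * (y - b) ^ n) has_sum f (a, y))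
        (Pair 0 ` UNIV)"
      by (rule has_sum_cong_neutral) (auto simp: image_iff power_0_left)
    also have "\<dots> \<longleftrightarrow> ((\<lambda>n. c 0 n * (y - b) ^ n) has_sum f (a, y)) UNIV"
      by (subst has_sum_reindex) (auto simp: inj_on_def o_def)
    finally show ?thesis
      by (rule has_sum_imp_sums)
  qed
  from power_series_extension[OF r this]
  show "\<exists>r>0. \<exists>g. g holomorphic_on ball (of_real b) r \<and>
      (\<forall>y. \<bar>y - b\<bar> < r \<longrightarrow> complex_of_real (f (a, y)) = g (of_real y))"
    using r by (intro exI[of _ r] conjI)
qed

section \<open>Substituting functions of one variable into \<open>R\<close>\<close>

lemma holomorphic3_compose:
  assumes f: "holomorphic3_on f U" and A: "open A"
    and hol: "p holomorphic_on A" "q holomorphic_on A" "w holomorphic_on A"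
    and sub: "\<And>z. z \<in> A \<Longrightarrow> (p z, q z, w z) \<in> U"
  shows "(\<lambda>z. f (p z, q z, w z)) holomorphic_on A"
proof (rule holomorphic_onI)
  fix z assume z: "z \<in> A"
  obtain a b c where D: "(f has_derivative (\<lambda>(x, y, z). a * x + b * y + c * z)) (at (p z, q z, w z))"
    using f sub[OF z] unfolding holomorphic3_on_def by blast
  obtain p' q' w' where "(p has_field_derivative p') (at z)" "(q has_field_derivative q') (at z)"
    "(w has_field_derivative w') (at z)"
    using hol z A by (meson field_differentiable_def holomorphic_on_imp_differentiable_at)
  then have "((\<lambda>z. (p z, q z, w z)) has_derivative (\<lambda>h. (p' * h, q' * h, w' * h))) (at z)"
    by (intro has_derivative_Pair) (auto simp: has_field_derivative_def)
  \<comment> \<open>Since the derivative of \<open>f\<close> is complex linear, the composed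
    derivative is multiplication by one complex number, hence a field derivative.\<close>
  from has_derivative_compose[OF this D]
  have "((\<lambda>z. f (p z, q z, w z)) has_field_derivative (a * p' + b * q' + c * w')) (at z)"
    unfolding has_field_derivative_def
    by (rule has_derivative_eq_rhs) (auto simp: algebra_simps fun_eq_iff)
  then show "(\<lambda>z. f (p z, q z, w z)) field_differentiable (at z within A)"
    by (meson field_differentiable_at_within field_differentiable_def)
qed

lemma open_slit_plane: "open slit_plane"
proof -
  have "slit_plane = (\<lambda>z. - \<i> * z) -` (- \<real>\<^sub>\<le>\<^sub>0)"
  proof (rule set_eqI, rule iffI)
    show "z \<in> (\<lambda>z. - \<i> * z) -` (- \<real>\<^sub>\<le>\<^sub>0)" if "z \<in> slit_plane" for z
      using slit_planeD(1)[OF that] by simp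
    show "z \<in> slit_plane" if "z \<in> (\<lambda>z. - \<i> * z) -` (- \<real>\<^sub>\<le>\<^sub>0)" for z
      using that by (auto simp: slit_plane_def complex_nonpos_Reals_iff)
  qed
  moreover have "open ((\<lambda>z. - \<i> * z) -` (- \<real>\<^sub>\<le>\<^sub>0))"
    by (intro open_vimage continuous_intros) (simp add: open_Compl)
  ultimately show ?thesis
    by simp
qed

lemma neg_exp_in_slit_plane: "- exp (complex_of_real s) \<in> slit_plane"
proof -
  have "Re (- exp (complex_of_real s)) < 0"
    by (simp add: Re_exp)
  then show ?thesis
    by (auto simp: slit_plane_def)
qed

text \<open>Off the real axis \<open>- exp (g z)\<close> may leave the slit plane, so the disc is
  shrunk to radius \<open>d\<close>; this is possible because the value at \<open>a\<close> is a
  negative real and the slit plane is open. Keeping \<open>p\<close> and \<open>q\<close> general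
  lets the result serve for continuation in \<alpha> as well as in \<theta>.\<close>

lemma locally_holomorphic_compose:
  assumes R: "holomorphic3_on R (UNIV \<times> UNIV \<times> slit_plane)"
    and h: "locally_holomorphic_on (\<lambda>x. of_real (h x)) I"
    and pq: "p holomorphic_on UNIV" "q holomorphic_on UNIV"
  shows "locally_holomorphic_on (\<lambda>x. R (p (of_real x), q (of_real x), - exp (of_real (h x)))) I"
  unfolding locally_holomorphic_on_def
proof
  fix a assume "a \<in> I"
  then obtain r g where r: "r > 0" and g: "g holomorphic_on ball (of_real a) r"
    and eq: "\<And>x. \<bar>x - a\<bar> < r \<Longrightarrow> complex_of_real (h x) = g (of_real x)"
    using h unfolding locally_holomorphic_on_def by blast
  define w where "w = (\<lambda>z. - exp (g z))"
  have w: "w holomorphic_on ball (of_real a) r"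
    unfolding w_def using g by (intro holomorphic_intros)
  have "open (w -` slit_plane \<inter> ball (of_real a) r)"
    using holomorphic_on_imp_continuous_on[OF w] open_slit_plane
    by (simp add: continuous_on_open_vimage)
  moreover have "complex_of_real a \<in> w -` slit_plane \<inter> ball (of_real a) r"
    using r neg_exp_in_slit_plane[of "h a"] eq[of a] by (simp add: w_def)
  ultimately obtain d where d: "d > 0"
    "ball (complex_of_real a) d \<subseteq> w -` slit_plane \<inter> ball (of_real a) r"
    by (meson open_contains_ball)
  have "(\<lambda>z. R (p z, q z, w z)) holomorphic_on ball (of_real a) d"
    by (rule holomorphic3_compose[OF R])
      (use d in \<open>auto intro: holomorphic_on_subset[OF pq(1)] holomorphic_on_subset[OF pq(2)]
        holomorphic_on_subset[OF w]\<close>)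
  moreover have "R (p (of_real x), q (of_real x), - exp (of_real (h x)))
      = R (p (of_real x), q (of_real x), w (of_real x))" if "\<bar>x - a\<bar> < d" for x
  proof -
    have "complex_of_real x \<in> ball (of_real a) d"
      using that by (simp add: dist_of_real dist_real_def abs_minus_commute)
    then have "complex_of_real x \<in> ball (of_real a) r"
      using d by blast
    then have "\<bar>x - a\<bar> < r"
      by (simp add: dist_of_real dist_real_def abs_minus_commute)
    then show ?thesis
      by (simp add: w_def eq)
  qed
  ultimately show "\<exists>r>0. \<exists>g. g holomorphic_on ball (of_real a) r \<and>
      (\<forall>x. \<bar>x - a\<bar> < r \<longrightarrow>
         R (p (of_real x), q (of_real x), - exp (of_real (h x))) = g (of_real x))"
    using d by (intro exI[of _ d] exI[of _ "\<lambda>z. R (p z, q z, w z)"] conjI allI impI)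
qed

section \<open>The zero equation on the negative axis for positive, zero and negative
  \<alpha>\<close>

lemma ln_slit_neg_exp: "ln_slit (- exp (complex_of_real s)) = of_real s + \<i> * of_real pi"
proof -
  have "exp (\<i> * of_real (pi / 2)) = \<i>"
    by (simp only: exp_Euler cos_of_real sin_of_real) simp
  then have "- \<i> * - exp (complex_of_real s) = exp (of_real s + \<i> * of_real (pi / 2))"
    by (simp add: exp_add)
  \<comment> \<open>After the rotation the imaginary part is \<open>pi / 2\<close>, inside the
    principal strip, so \<open>Ln\<close> inverts \<open>exp\<close> here.\<close>
  moreover have "Ln (exp (of_real s + \<i> * of_real (pi / 2))) = of_real s + \<i> * of_real (pi / 2)"
    by (rule Ln_exp) (auto simp: pi_gt_zero less_imp_le)
  ultimately have "ln_slit (- exp (of_real s)) = of_real s + \<i> * of_real (pi / 2) + \<i> * of_real (pi / 2)"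
    unfolding ln_slit_def by (simp only:)
  then show ?thesis
    by (simp add: complex_eq_iff)
qed

text \<open>Negative numbers have argument \<open>pi\<close> in this branch, and the factors
  \<open>exp (\<plusminus> \<i> * pi * \<kappa> / 2)\<close> in \<open>R\<close> cancel exactly the
  phases this produces in the powers.\<close>

lemma is_R_neg_exp:
  assumes "is_R R" "\<kappa> \<noteq> 0"
  shows "R (\<kappa>\<^sup>2, \<theta>, - exp (of_real s)) = 1 / \<kappa> *
    (exp (- \<kappa> * of_real s / 2) * cos (\<theta> - of_real pi * \<kappa> / 2)
      - exp (\<kappa> * of_real s / 2) * cos (\<theta> + of_real pi * \<kappa> / 2))"
proof -
  have 1: "exp (- \<kappa> / 2 * (of_real s + \<i> * of_real pi)) * exp (\<i> * of_real pi * \<kappa> / 2)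
      = exp (- \<kappa> * of_real s / 2)"
    unfolding exp_add[symmetric] by (rule arg_cong[where f = exp]) (simp add: field_simps)
  have 2: "exp (\<kappa> / 2 * (of_real s + \<i> * of_real pi)) * exp (- \<i> * of_real pi * \<kappa> / 2)
      = exp (\<kappa> * of_real s / 2)"
    unfolding exp_add[symmetric] by (rule arg_cong[where f = exp]) (simp add: field_simps)
  have "R (\<kappa>\<^sup>2, \<theta>, - exp (of_real s)) = 1 / \<kappa> *
    (pow_slit (- exp (of_real s)) (- \<kappa> / 2) * exp (\<i> * of_real pi * \<kappa> / 2) * cos (\<theta> - vartheta \<kappa>)
     - pow_slit (- exp (of_real s)) (\<kappa> / 2) * exp (- \<i> * of_real pi * \<kappa> / 2) * cos (\<theta> + vartheta \<kappa>))"
    using assms neg_exp_in_slit_plane unfolding is_R_def by blast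
  then show ?thesis
    unfolding pow_slit_def vartheta_def ln_slit_neg_exp 1 2 .
qed

lemma N_set_iff: "s \<in> N_set R \<alpha> \<theta> \<longleftrightarrow> R (of_real \<alpha>, of_real \<theta>, - exp (of_real s)) = 0"
  unfolding N_set_def Sigma_set_def by (simp add: exp_of_real)

lemma N_set_pos_iff:
  assumes "is_R R" "\<kappa> > 0"
  shows "s \<in> N_set R (\<kappa>\<^sup>2) \<theta> \<longleftrightarrow>
    cos (\<theta> - pi * \<kappa> / 2) = exp (\<kappa> * s) * cos (\<theta> + pi * \<kappa> / 2)"
proof -
  have "R (of_real (\<kappa>\<^sup>2), of_real \<theta>, - exp (of_real s)) = of_real (1 / \<kappa> *
      (exp (- \<kappa> * s / 2) * cos (\<theta> - pi * \<kappa> / 2) - exp (\<kappa> * s / 2) * cos (\<theta> + pi * \<kappa> / 2)))"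
    using is_R_neg_exp[OF assms(1), of "of_real \<kappa>" "of_real \<theta>" s] assms(2)
    by (simp flip: exp_of_real cos_of_real)
  then have "s \<in> N_set R (\<kappa>\<^sup>2) \<theta> \<longleftrightarrow> exp (- \<kappa> * s / 2) * cos (\<theta> - pi * \<kappa> / 2)
      = exp (\<kappa> * s / 2) * cos (\<theta> + pi * \<kappa> / 2)"
    unfolding N_set_iff using assms(2) by (simp only: of_real_eq_0_iff) simp
  also have "exp (\<kappa> * s / 2) = exp (- \<kappa> * s / 2) * exp (\<kappa> * s)"
    unfolding exp_add[symmetric] by (rule arg_cong[where f = exp]) (simp add: field_simps)
  finally show ?thesis
    by simp
qed

text \<open>The defining formula excludes \<open>\<kappa> = 0\<close>, so the value there is
  recovered from continuity of \<open>R\<close>. As \<open>h 0 = 0\<close>, the limit of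
  \<open>h \<kappa> / \<kappa>\<close> is the derivative of \<open>h\<close> at 0.\<close>

lemma N_set_zero_iff:
  assumes "is_R R"
  shows "s \<in> N_set R 0 \<theta> \<longleftrightarrow> s * cos \<theta> = pi * sin \<theta>"
proof -
  define z where "z = - exp (complex_of_real s)"
  define h where "h = (\<lambda>\<kappa>::complex. exp (- \<kappa> * of_real s / 2) * cos (of_real \<theta> - of_real pi * \<kappa> / 2)
      - exp (\<kappa> * of_real s / 2) * cos (of_real \<theta> + of_real pi * \<kappa> / 2))"
  have "(h has_field_derivative of_real (pi * sin \<theta> - s * cos \<theta>)) (at 0)"
    unfolding h_def
    by (rule derivative_eq_intros refl | simp)+ (simp add: cos_of_real sin_of_real field_simps)
  then have lim: "((\<lambda>\<kappa>. h \<kappa> / \<kappa>) \<longlongrightarrow> of_real (pi * sin \<theta> - s * cos \<theta>)) (at 0)"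
    unfolding DERIV_def by (simp add: h_def)
  have "(0, of_real \<theta>, z) \<in> UNIV \<times> UNIV \<times> slit_plane"
    by (simp add: z_def neg_exp_in_slit_plane)
  then have "isCont R (0, of_real \<theta>, z)"
    using assms has_derivative_continuous unfolding is_R_def holomorphic3_on_def by blast
  moreover have "((\<lambda>\<kappa>::complex. (\<kappa>\<^sup>2, of_real \<theta>, z)) \<longlongrightarrow> (0\<^sup>2, of_real \<theta>, z)) (at 0)"
    by (intro tendsto_intros)
  ultimately have "((\<lambda>\<kappa>. R (\<kappa>\<^sup>2, of_real \<theta>, z)) \<longlongrightarrow> R (0, of_real \<theta>, z)) (at 0)"
    using isCont_tendsto_compose by fastforce
  moreover have "\<forall>\<^sub>F \<kappa> in at 0. R (\<kappa>\<^sup>2, of_real \<theta>, z) = h \<kappa> / \<kappa>"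
    using is_R_neg_exp[OF assms] by (auto simp: eventually_at_filter z_def h_def)
  ultimately have "((\<lambda>\<kappa>. h \<kappa> / \<kappa>) \<longlongrightarrow> R (0, of_real \<theta>, z)) (at 0)"
    by (simp add: tendsto_cong)
  from tendsto_unique[OF _ this lim] have "R (0, of_real \<theta>, z) = of_real (pi * sin \<theta> - s * cos \<theta>)"
    by simp
  then show ?thesis
    unfolding N_set_iff z_def by (simp only: of_real_0 of_real_eq_0_iff) auto
qed

text \<open>For \<open>\<kappa> = \<i> * \<mu>\<close> the two terms of the formula are complex
  conjugates, so their difference vanishes exactly when \<open>Im w = 0\<close>.\<close>

lemma N_set_neg_iff:
  assumes "is_R R" "\<mu> > 0"
  shows "s \<in> N_set R (- \<mu>\<^sup>2) \<theta> \<longleftrightarrow>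
    sin (\<mu> * s / 2) * (cosh (pi * \<mu> / 2) * cos \<theta>) = cos (\<mu> * s / 2) * (sinh (pi * \<mu> / 2) * sin \<theta>)"
proof -
  define y where "y = pi * \<mu> / 2"
  define w where "w = exp (\<i> * of_real \<mu> * of_real s / 2) * cos (of_real \<theta> + of_real pi * (\<i> * of_real \<mu>) / 2)"
  have "cnj w = exp (- (\<i> * of_real \<mu>) * of_real s / 2) * cos (of_real \<theta> - of_real pi * (\<i> * of_real \<mu>) / 2)"
    unfolding w_def by (simp add: exp_cnj cnj_cos)
  then have "R (of_real (- \<mu>\<^sup>2), of_real \<theta>, - exp (of_real s)) = 1 / (\<i> * of_real \<mu>) * (cnj w - w)"
    using is_R_neg_exp[OF assms(1), of "\<i> * of_real \<mu>" "of_real \<theta>" s] assms(2)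
    by (simp add: w_def power_mult_distrib)
  moreover have "cnj w - w = 0 \<longleftrightarrow> Im w = 0"
    by (simp add: complex_eq_iff)
  ultimately have "s \<in> N_set R (- \<mu>\<^sup>2) \<theta> \<longleftrightarrow> Im w = 0"
    unfolding N_set_iff using assms(2) by simp
  \<comment> \<open>The first factor is \<open>exp (\<i> * \<mu> * s / 2)\<close>, the second the
    expansion of the cosine at \<open>\<theta> + \<i> * y\<close>.\<close>
  moreover have "w = Complex (cos (\<mu> * s / 2)) (sin (\<mu> * s / 2)) *
      Complex (cosh y * cos \<theta>) (- (sinh y * sin \<theta>))"
    unfolding w_def
    by (intro arg_cong2[where f = "(*)"])
      (simp_all add: complex_eq_iff Re_exp Im_exp Re_cos Im_cos y_def cosh_field_def sinh_field_def
        field_simps)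
  ultimately show ?thesis
    unfolding y_def by (simp add: algebra_simps)
qed

text \<open>Brings the three sign cases of \<alpha> into one shape by the addition formulas, so that
  periodicity needs no case distinction.\<close>

lemma N_set_linear:
  assumes "is_R R"
  shows "\<exists>a b. \<forall>\<theta>. s \<in> N_set R \<alpha> \<theta> \<longleftrightarrow> a * cos \<theta> = b * sin \<theta>"
proof -
  consider "\<alpha> > 0" | "\<alpha> = 0" | "\<alpha> < 0"
    by linarith
  then show ?thesis
  proof cases
    case 1
    have "s \<in> N_set R \<alpha> \<theta> \<longleftrightarrow> ((exp (sqrt \<alpha> * s) - 1) * cos (pi * sqrt \<alpha> / 2)) * cos \<theta>
        = ((exp (sqrt \<alpha> * s) + 1) * sin (pi * sqrt \<alpha> / 2)) * sin \<theta>" for \<theta>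
      using N_set_pos_iff[OF assms, of "sqrt \<alpha>" s \<theta>] 1
      by (auto simp: cos_diff cos_add algebra_simps)
    then show ?thesis by blast
  next
    case 2
    then show ?thesis using N_set_zero_iff[OF assms] by blast
  next
    case 3
    have "s \<in> N_set R \<alpha> \<theta> \<longleftrightarrow> (sin (sqrt (- \<alpha>) * s / 2) * cosh (pi * sqrt (- \<alpha>) / 2)) * cos \<theta>
        = (cos (sqrt (- \<alpha>) * s / 2) * sinh (pi * sqrt (- \<alpha>) / 2)) * sin \<theta>" for \<theta>
      using N_set_neg_iff[OF assms, of "sqrt (- \<alpha>)" s \<theta>] 3 by (simp add: mult.assoc)
    then show ?thesis by blast
  qed
qed

lemma N_set_periodic:
  assumes "is_R R"
  shows "N_set R \<alpha> (\<theta> + pi * of_int k) = N_set R \<alpha> \<theta>"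
proof (rule set_eqI)
  fix s
  obtain a b where ab: "\<And>\<theta>. s \<in> N_set R \<alpha> \<theta> \<longleftrightarrow> a * cos \<theta> = b * sin \<theta>"
    using N_set_linear[OF assms] by blast
  have sin0: "sin (pi * of_int k) = 0"
    by (simp add: sin_zero_iff_int2 mult.commute)
  \<comment> \<open>The shift multiplies both \<open>cos \<theta>\<close> and
    \<open>sin \<theta>\<close> by this number. Its sign is irrelevant; it only has to be
    cancellable.\<close>
  have cos0: "cos (pi * of_int k) \<noteq> 0"
    using sin_cos_squared_add[of "pi * of_int k"] by (auto simp: sin0)
  show "s \<in> N_set R \<alpha> (\<theta> + pi * of_int k) \<longleftrightarrow> s \<in> N_set R \<alpha> \<theta>"
    using cos0 by (simp add: ab cos_add sin_add sin0)
qed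

section \<open>The region \<open>W\<close> and the explicit solution for
  \<open>0 < \<alpha> < 1\<close>\<close>

lemma W_iff_nonneg:
  assumes "\<alpha> \<ge> 0"
  shows "(\<alpha>, \<theta>) \<in> W \<longleftrightarrow> \<bar>\<theta>\<bar> < pi / 2 \<and> pi * sqrt \<alpha> / 2 + \<bar>\<theta>\<bar> < pi / 2"
proof (cases "\<bar>\<theta>\<bar> < pi / 2")
  case True
  then have pos: "1 - 2 * \<bar>\<theta>\<bar> / pi > 0"
    by (simp add: field_simps)
  have "(\<alpha>, \<theta>) \<in> W \<longleftrightarrow> \<alpha> < (1 - 2 * \<bar>\<theta>\<bar> / pi)\<^sup>2"
    using True assms by (auto simp: W_def Q1_def Qinf_def omega_eq)
  also have "\<dots> \<longleftrightarrow> sqrt \<alpha> < 1 - 2 * \<bar>\<theta>\<bar> / pi"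
    using pos assms by (metis abs_of_pos real_sqrt_abs real_sqrt_less_iff)
  also have "\<dots> \<longleftrightarrow> pi * sqrt \<alpha> < pi * (1 - 2 * \<bar>\<theta>\<bar> / pi)"
    by simp
  also have "\<dots> \<longleftrightarrow> pi * sqrt \<alpha> / 2 + \<bar>\<theta>\<bar> < pi / 2"
    by (simp add: right_diff_distrib) linarith
  finally show ?thesis
    using True by simp
next
  case False
  then show ?thesis
    using assms by (auto simp: W_def Qinf_def)
qed

lemma W_neg: "\<alpha> < 0 \<Longrightarrow> (\<alpha>, \<theta>) \<in> W"
  by (simp add: W_def Qinf_def)

lemma W0_iff: "(\<alpha>, \<theta>) \<in> W0 \<longleftrightarrow> \<alpha> > 0 \<and> (\<alpha>, \<theta>) \<in> W"
  unfolding W0_def W_def Qinf_def by (cases "\<alpha> > 0") (simp_all add: conj_ac)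

text \<open>With \<open>u = pi * sqrt \<alpha> / 2\<close>, membership in \<open>W\<close> means
  that both \<open>\<theta> - u\<close> and \<open>\<theta> + u\<close> lie in the open interval
  where the cosine is positive, so a logarithm solves the equation. Outside \<open>W\<close> one of
  the two cosines is positive and the other is not, which no positive factor
  \<open>exp (\<kappa> * s)\<close> can reconcile.\<close>

lemma N_set_pos:
  assumes R: "is_R R" and \<alpha>: "0 < \<alpha>" "\<alpha> < 1" and \<theta>: "\<bar>\<theta>\<bar> \<le> pi / 2"
  shows "s \<in> N_set R \<alpha> \<theta> \<longleftrightarrow> (\<alpha>, \<theta>) \<in> W \<and> s = S0 (\<alpha>, \<theta>)"
proof -
  define \<kappa> u where "\<kappa> = sqrt \<alpha>" and "u = pi * \<kappa> / 2"
  have \<kappa>: "0 < \<kappa>" "\<kappa> < 1" "\<alpha> = \<kappa>\<^sup>2"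
    using \<alpha> by (auto simp: \<kappa>_def)
  have u: "0 < u" "u < pi / 2"
    using \<kappa> by (auto simp: u_def)
  have N: "s \<in> N_set R \<alpha> \<theta> \<longleftrightarrow> cos (\<theta> - u) = exp (\<kappa> * s) * cos (\<theta> + u)"
    using N_set_pos_iff[OF R \<kappa>(1)] by (simp add: \<kappa>(3) u_def)
  have W: "(\<alpha>, \<theta>) \<in> W \<longleftrightarrow> u + \<bar>\<theta>\<bar> < pi / 2"
    using W_iff_nonneg[of \<alpha> \<theta>] \<alpha>(1) u(1) unfolding u_def[symmetric] \<kappa>_def[symmetric] by auto
  show ?thesis
  proof (cases "u + \<bar>\<theta>\<bar> < pi / 2")
    case True
    have pos: "cos (\<theta> - u) > 0" "cos (\<theta> + u) > 0"
      using True u by (auto intro!: cos_gt_zero_pi)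
    have "cos (\<theta> - u) = exp (\<kappa> * s) * cos (\<theta> + u) \<longleftrightarrow> exp (\<kappa> * s) = cos (\<theta> - u) / cos (\<theta> + u)"
      using pos by (auto simp: field_simps)
    also have "\<dots> \<longleftrightarrow> \<kappa> * s = ln (cos (\<theta> - u) / cos (\<theta> + u))"
      using pos by (metis divide_pos_pos exp_ln ln_exp)
    also have "\<dots> \<longleftrightarrow> s = S0 (\<alpha>, \<theta>)"
      using \<kappa>(1) by (auto simp: S0_def \<kappa>_def[symmetric] u_def field_simps)
    finally show ?thesis
      using N W True by simp
  next
    case False
    have neg: "cos (\<bar>\<theta>\<bar> + u) \<le> 0"
    proof -
      \<comment> \<open>Here \<open>\<bar>\<theta>\<bar> + u\<close> is at least
        \<open>pi / 2\<close> and less than \<open>pi\<close>; subtracting \<open>pi\<close> lands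
        where the cosine is nonnegative.\<close>
      have "- cos (\<bar>\<theta>\<bar> + u) = cos (\<bar>\<theta>\<bar> + u - pi)"
        by simp
      also have "\<dots> \<ge> 0"
        using False u \<theta> by (intro cos_ge_zero) auto
      finally show ?thesis by simp
    qed
    have pos: "cos (\<bar>\<theta>\<bar> - u) > 0"
      using u \<theta> by (intro cos_gt_zero_pi) auto
    have "cos (\<theta> - u) \<noteq> exp (\<kappa> * s) * cos (\<theta> + u)"
    proof (cases "\<theta> \<ge> 0")
      case True
      then show ?thesis
        using neg pos mult_nonneg_nonpos[of "exp (\<kappa> * s)" "cos (\<theta> + u)"] by auto
    next
      case False
      \<comment> \<open>For negative \<theta> the two cosines exchange roles, because the cosine is
        even.\<close>
      have "cos (\<theta> - u) \<le> 0" "cos (\<theta> + u) > 0"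
        using neg pos False cos_minus[of "\<theta> - u"] cos_minus[of "\<theta> + u"] by (auto simp: algebra_simps)
      then show ?thesis
        by (smt (verit) exp_gt_zero mult_pos_pos)
    qed
    then show ?thesis
      using N W False by blast
  qed
qed

section \<open>Values of \<open>S\<close> solve the zero equation\<close>

lemma S_in_N_set_strip:
  assumes R: "is_R R" and S: "is_S S" and \<theta>: "\<bar>\<theta>\<bar> < pi / 2" and W: "(\<alpha>, \<theta>) \<in> W" and "\<alpha> < 1"
  shows "S (\<alpha>, \<theta>) \<in> N_set R \<alpha> \<theta>"
proof -
  define c where "c = (1 - 2 * \<bar>\<theta>\<bar> / pi)\<^sup>2"
  have c: "0 < c" "c \<le> 1"
    using \<theta> by (auto simp: c_def field_simps abs_square_le_1)
  have "omega \<theta> = c"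
    using \<theta> by (simp add: omega_eq c_def)
  \<comment> \<open>For \<theta> in the strip the slice of \<open>W\<close> is a half-line, hence
    connected, and it reaches from the region of \<open>S0\<close> past 0 to all negative
    \<alpha>.\<close>
  then have I: "{x. (x, \<theta>) \<in> W} = {..<c}"
    using \<theta> c by (auto simp: W_def Q1_def Qinf_def)
  have "locally_holomorphic_on (\<lambda>x. of_real (S (x, \<theta>))) {..<c}"
    using real_analytic2_slice1[of S W \<theta>] S unfolding is_S_def I by blast
  then have "locally_holomorphic_on
      (\<lambda>x. R (of_real x, of_real \<theta>, - exp (of_real (S (x, \<theta>))))) {..<c}"
    using locally_holomorphic_compose[of R "\<lambda>x. S (x, \<theta>)" "{..<c}" "\<lambda>z. z" "\<lambda>_. of_real \<theta>"] R
    unfolding is_R_def by auto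
  then have "R (of_real \<alpha>, of_real \<theta>, - exp (of_real (S (\<alpha>, \<theta>)))) = 0"
  proof (rule locally_holomorphic_zero[where U = "{0<..<c}"])
    fix x assume x: "x \<in> {0<..<c}"
    then have "x \<in> {x. (x, \<theta>) \<in> W}"
      unfolding I by simp
    then have xW: "(x, \<theta>) \<in> W"
      by simp
    then have "S (x, \<theta>) = S0 (x, \<theta>)"
      using S x by (simp add: is_S_def W0_iff)
    then show "R (of_real x, of_real \<theta>, - exp (of_real (S (x, \<theta>)))) = 0"
      using N_set_pos[OF R, of x \<theta> "S (x, \<theta>)"] x c xW \<theta> by (simp add: N_set_iff)
  next
    show "\<alpha> \<in> {..<c}"
      using W unfolding I[symmetric] by simp
    show "{0<..<c} \<noteq> {}"
      using c by simp
  qed auto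
  then show ?thesis
    by (simp add: N_set_iff)
qed

text \<open>Outside the strip a slice of \<open>W\<close> in \<alpha> contains only negative
  \<alpha> and never meets \<open>W0\<close>, so continuation in \<alpha> has nowhere to start. For
  fixed negative \<alpha> the slice in \<theta> is the whole line, and continuation starts from the
  strip.\<close>

lemma S_in_N_set:
  assumes R: "is_R R" and S: "is_S S" and W: "(\<alpha>, \<theta>) \<in> W" and "\<alpha> < 1"
  shows "S (\<alpha>, \<theta>) \<in> N_set R \<alpha> \<theta>"
proof (cases "\<alpha> < 0")
  case True
  have I: "{x. (\<alpha>, x) \<in> W} = UNIV"
    using W_neg[OF True] by auto
  have "locally_holomorphic_on (\<lambda>x. of_real (S (\<alpha>, x))) UNIV"
    using real_analytic2_slice2[of S W \<alpha>] S unfolding is_S_def I by blast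
  then have "locally_holomorphic_on
      (\<lambda>x. R (of_real \<alpha>, of_real x, - exp (of_real (S (\<alpha>, x))))) UNIV"
    using locally_holomorphic_compose[of R "\<lambda>x. S (\<alpha>, x)" UNIV "\<lambda>_. of_real \<alpha>" "\<lambda>z. z"] R
    unfolding is_R_def by auto
  then have "R (of_real \<alpha>, of_real \<theta>, - exp (of_real (S (\<alpha>, \<theta>)))) = 0"
  proof (rule locally_holomorphic_zero[where U = "{- pi / 2<..<pi / 2}"])
    fix x assume "x \<in> {- pi / 2<..<pi / 2}"
    then have "S (\<alpha>, x) \<in> N_set R \<alpha> x"
      using S_in_N_set_strip[OF R S, of x \<alpha>] True W_neg by auto
    then show "R (of_real \<alpha>, of_real x, - exp (of_real (S (\<alpha>, x)))) = 0"
      by (simp add: N_set_iff)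
  next
    have "0 \<in> {- pi / 2<..<pi / 2}"
      by simp
    then show "{- pi / 2<..<pi / 2} \<noteq> {}"
      by blast
  qed auto
  then show ?thesis
    by (simp add: N_set_iff)
next
  case False
  then show ?thesis
    using S_in_N_set_strip[OF R S] W W_iff_nonneg assms(4) by auto
qed

section \<open>Surjectivity of a continuous phase\<close>

lemma sin_diff_zero_if_proportional:
  fixes p q x y :: real
  assumes "p * cos x = q * sin x" "p * cos y = q * sin y" "p \<noteq> 0 \<or> q \<noteq> 0"
  shows "sin (x - y) = 0"
proof -
  \<comment> \<open>The vectors \<open>(cos x, sin x)\<close> and \<open>(cos y, sin y)\<close> are
    both orthogonal to \<open>(p, - q)\<close>; up to sign, \<open>sin (x - y)\<close> is their
    determinant.\<close>
  have "p * sin (x - y) = sin x * (p * cos y) - (p * cos x) * sin y"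
    by (simp add: sin_diff algebra_simps)
  also have "\<dots> = 0"
    unfolding assms(1,2) by simp
  finally have "p * sin (x - y) = 0" .
  have "q * sin (x - y) = (q * sin x) * cos y - cos x * (q * sin y)"
    by (simp add: sin_diff algebra_simps)
  also have "\<dots> = 0"
    unfolding assms(1,2)[symmetric] by simp
  finally have "q * sin (x - y) = 0" .
  with \<open>p * sin (x - y) = 0\<close> assms(3) show ?thesis
    by (metis mult_eq_0_iff)
qed

lemma IVT_between:
  fixes u :: "real \<Rightarrow> real"
  assumes "continuous_on {x..y} u" "x \<le> y" "min (u x) (u y) \<le> v" "v \<le> max (u x) (u y)"
  obtains t where "x \<le> t" "t \<le> y" "u t = v"
  using IVT'[of u x v y] IVT2'[of u y v x] assms by (metis le_cases max.absorb1 max.absorb2 min.absorb1 min.absorb2)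

text \<open>Where the tangents exist, \<open>eq\<close> says that \<open>tan (u x)\<close> is a
  constant multiple of \<open>tan x\<close>. Hence \<open>u\<close> moves by a multiple of
  \<open>pi\<close> over each period, and equal values of \<open>u\<close> occur only at points
  congruent modulo \<open>pi\<close>.\<close>

lemma surj_if_tan_proportional:
  fixes u :: "real \<Rightarrow> real"
  assumes cont: "continuous_on UNIV u" and ab: "a \<noteq> 0" "b \<noteq> 0"
    and eq: "\<And>x. sin (u x) * (a * cos x) = cos (u x) * (b * sin x)"
  shows "surj u"
proof -
  have inj: "sin (x - y) = 0" if "u x = u y" for x y
  proof (rule sin_diff_zero_if_proportional)
    show "(sin (u x) * a) * cos x = (cos (u x) * b) * sin x"
      using eq[of x] by (simp add: mult.assoc)
    show "(sin (u x) * a) * cos y = (cos (u x) * b) * sin y"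
      using eq[of y] that by (simp add: mult.assoc)
    show "sin (u x) * a \<noteq> 0 \<or> cos (u x) * b \<noteq> 0"
      using ab sin_zero_abs_cos_one by fastforce
  qed
  define D where "D = (\<lambda>x. u (x + pi) - u x)"
  have D_int: "\<exists>k::int. D x = of_int k * pi" for x
  proof -
    \<comment> \<open>Replacing \<open>x\<close> by \<open>x + pi\<close> flips the sign of both
      \<open>cos x\<close> and \<open>sin x\<close>, so \<open>u (x + pi)\<close> and
      \<open>u x\<close> satisfy the same linear relation, now read with \<open>b * sin x\<close>
      and \<open>a * cos x\<close> as coefficients.\<close>
    have "sin (u (x + pi) - u x) = 0"
    proof (rule sin_diff_zero_if_proportional)
      show "(b * sin x) * cos (u (x + pi)) = (a * cos x) * sin (u (x + pi))"
        using eq[of "x + pi"] by (simp add: mult.commute)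
      show "(b * sin x) * cos (u x) = (a * cos x) * sin (u x)"
        using eq[of x] by (simp add: mult.commute)
      show "b * sin x \<noteq> 0 \<or> a * cos x \<noteq> 0"
        using ab sin_zero_abs_cos_one by fastforce
    qed
    then show ?thesis
      by (simp add: D_def sin_zero_iff_int2)
  qed
  \<comment> \<open>Distinct values of \<open>D\<close> are at least \<open>pi\<close> apart, so
    continuity makes \<open>D\<close> constant.\<close>
  have "D constant_on UNIV"
  proof (rule continuous_discrete_range_constant)
    show "continuous_on UNIV D"
      unfolding D_def using cont
      by (intro continuous_intros) (auto intro!: continuous_intros continuous_on_compose2[OF cont])
    fix x
    have "pi \<le> norm (D y - D x)" if "D y \<noteq> D x" for y
    proof -
      obtain k l :: int where kl: "D y = of_int k * pi" "D x = of_int l * pi"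
        using D_int by metis
      then have "1 \<le> \<bar>k - l\<bar>"
        using that by auto
      then have "1 * pi \<le> \<bar>of_int (k - l)\<bar> * pi"
        by (intro mult_right_mono) (use pi_gt_zero in linarith)+
      then show ?thesis
        by (simp add: kl abs_mult flip: left_diff_distrib)
    qed
    then show "\<exists>e>0. \<forall>y. y \<in> UNIV \<and> D y \<noteq> D x \<longrightarrow> e \<le> norm (D y - D x)"
      using pi_gt_zero by blast
  qed auto
  then obtain c where c: "\<And>x. u (x + pi) = u x + c"
    unfolding constant_on_def D_def by (metis UNIV_I diff_eq_eq add.commute)
  \<comment> \<open>If \<open>c = 0\<close>, then \<open>u\<close> takes the same values on both sides of \<open>0\<close> within one period, against \<open>inj\<close>.\<close>
  have "c \<noteq> 0"
  proof
    assume "c = 0"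
    then have per: "u (- (pi / 2)) = u (pi / 2)"
      using c[of "- (pi / 2)"] by simp
    have ne: "u 0 \<noteq> u (pi / 2)"
      using inj[of "pi / 2" 0] by auto
    \<comment> \<open>The midpoint differs from both end values. This keeps \<open>s\<close> off the
      ends of its interval and makes \<open>0 < s - t < pi\<close> strict.\<close>
    define v where "v = (u 0 + u (pi / 2)) / 2"
    obtain s where s: "0 \<le> s" "s \<le> pi / 2" "u s = v"
      by (rule IVT_between[of 0 "pi / 2" u v])
        (auto simp: v_def min_def max_def intro: continuous_on_subset[OF cont])
    obtain t where t: "- (pi / 2) \<le> t" "t \<le> 0" "u t = v"
      by (rule IVT_between[of "- (pi / 2)" 0 u v])
        (auto simp: v_def min_def max_def per intro: continuous_on_subset[OF cont])
    have "u s \<noteq> u 0" "u s \<noteq> u (pi / 2)"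
      using s(3) ne by (auto simp: v_def)
    then have "s \<noteq> 0" "s \<noteq> pi / 2"
      by blast+
    then have "sin (s - t) > 0"
      using s t by (intro sin_gt_zero) auto
    then show False
      using inj[of s t] s t by auto
  qed
  have up: "u (x + real n * pi) = u x + real n * c" for x n
  proof (induction n)
    case (Suc n)
    have "u (x + real (Suc n) * pi) = u (x + real n * pi + pi)"
      by (rule arg_cong[where f = u]) (simp add: algebra_simps)
    also have "\<dots> = u x + real n * c + c"
      by (simp only: c Suc.IH)
    finally show ?case
      by (simp add: algebra_simps)
  qed simp
  show ?thesis
    unfolding surj_def
  proof
    fix v
    \<comment> \<open>Going \<open>n\<close> periods in both directions gives the end values
      \<open>u 0 + n * c\<close> and \<open>u 0 - n * c\<close>, which enclose \<open>v\<close> for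
      either sign of \<open>c\<close>.\<close>
    obtain n :: nat where n: "\<bar>v - u 0\<bar> \<le> real n * \<bar>c\<bar>"
      using reals_Archimedean3[of "\<bar>c\<bar>"] \<open>c \<noteq> 0\<close> by (force intro: less_imp_le)
    have *: "u (real n * pi) = u 0 + real n * c" "u (- (real n * pi)) = u 0 - real n * c"
      using up[of 0 n] up[of "- (real n * pi)" n] by auto
    obtain t where "u t = v"
    proof (rule IVT_between[of "- (real n * pi)" "real n * pi" u v])
      show "min (u (- (real n * pi))) (u (real n * pi)) \<le> v"
        "v \<le> max (u (- (real n * pi))) (u (real n * pi))"
        using n unfolding * by (cases "c \<ge> 0"; auto simp: abs_le_iff min_def max_def)+
    qed (auto intro: continuous_on_subset[OF cont])
    then show "\<exists>x. v = u x" by metis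
  qed
qed

section \<open>Every solution is a value of \<open>S\<close>\<close>

lemma N_set_neg_subset:
  assumes R: "is_R R" and S: "is_S S" and \<alpha>: "\<alpha> < 0" and s: "s \<in> N_set R \<alpha> \<theta>"
  shows "\<exists>k::int. s = S (\<alpha>, \<theta> + pi * of_int k)"
proof -
  define \<mu> a b where "\<mu> = sqrt (- \<alpha>)" and "a = cosh (pi * \<mu> / 2)" and "b = sinh (pi * \<mu> / 2)"
  have \<mu>: "\<mu> > 0" "\<alpha> = - \<mu>\<^sup>2"
    using \<alpha> by (auto simp: \<mu>_def)
  have ab: "a \<noteq> 0" "b \<noteq> 0"
    using \<mu>(1) by (auto simp: a_def b_def)
  have N: "t \<in> N_set R \<alpha> x \<longleftrightarrow> sin (\<mu> * t / 2) * (a * cos x) = cos (\<mu> * t / 2) * (b * sin x)" for t x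
    using N_set_neg_iff[OF R \<mu>(1)] by (simp add: \<mu>(2) a_def b_def)
  have SN: "S (\<alpha>, x) \<in> N_set R \<alpha> x" for x
    using S_in_N_set[OF R S] W_neg \<alpha> by simp
  have "continuous_on UNIV (\<lambda>x. complex_of_real (S (\<alpha>, x)))"
    using locally_holomorphic_imp_continuous[OF real_analytic2_slice2[of S W \<alpha>]] S W_neg[OF \<alpha>]
    by (simp add: is_S_def)
  from continuous_on_Re[OF this] have "continuous_on UNIV (\<lambda>x. \<mu> * S (\<alpha>, x) / 2)"
    by (auto intro!: continuous_intros)
  then have "surj (\<lambda>x. \<mu> * S (\<alpha>, x) / 2)"
    by (rule surj_if_tan_proportional[OF _ ab]) (use SN N in blast)
  then obtain x where "\<mu> * s / 2 = \<mu> * S (\<alpha>, x) / 2"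
    by (rule surjE)
  then have x: "s = S (\<alpha>, x)"
    using \<mu>(1) by simp
  \<comment> \<open>For the fixed \<open>s\<close> the zero equation is a nontrivial linear relation
    between cosine and sine, satisfied at both \<open>x\<close> and \<theta>.\<close>
  have "sin (x - \<theta>) = 0"
  proof (rule sin_diff_zero_if_proportional)
    show "(sin (\<mu> * s / 2) * a) * cos x = (cos (\<mu> * s / 2) * b) * sin x"
      using SN[of x] N[of s x] x by (simp add: mult.assoc)
    show "(sin (\<mu> * s / 2) * a) * cos \<theta> = (cos (\<mu> * s / 2) * b) * sin \<theta>"
      using s N[of s \<theta>] by (simp add: mult.assoc)
    show "sin (\<mu> * s / 2) * a \<noteq> 0 \<or> cos (\<mu> * s / 2) * b \<noteq> 0"
      using ab sin_zero_abs_cos_one by fastforce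
  qed
  then obtain k :: int where "x - \<theta> = of_int k * pi"
    by (auto simp: sin_zero_iff_int2)
  then have "x = \<theta> + pi * of_int k"
    by (simp add: algebra_simps)
  then show ?thesis
    using x by blast
qed

lemma ex_shift_into_strip: "\<exists>k::int. - pi / 2 \<le> \<theta> + pi * of_int k \<and> \<theta> + pi * of_int k < pi / 2"
proof -
  define k where "k = - \<lfloor>\<theta> / pi + 1 / 2\<rfloor>"
  have "- of_int k \<le> \<theta> / pi + 1 / 2" "\<theta> / pi + 1 / 2 < - of_int k + 1"
    unfolding k_def by (simp_all add: floor_correct)
  then have "- pi / 2 \<le> \<theta> + pi * of_int k" "\<theta> + pi * of_int k < pi / 2"
    by (simp_all add: field_simps)
  then show ?thesis by blast
qed

text \<open>\<open>S0\<close> gives no information at \<open>\<alpha> = 0\<close>. There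
  \<open>S\<close> is identified by uniqueness: it solves an equation linear in \<open>s\<close>
  whose coefficient \<open>cos \<theta>\<close> is nonzero.\<close>

lemma N_set_nonneg_subset:
  assumes R: "is_R R" and S: "is_S S" and \<alpha>: "0 \<le> \<alpha>" "\<alpha> < 1"
    and \<theta>: "- pi / 2 \<le> \<theta>" "\<theta> < pi / 2" and s: "s \<in> N_set R \<alpha> \<theta>"
  shows "(\<alpha>, \<theta>) \<in> W \<and> s = S (\<alpha>, \<theta>)"
proof (cases "\<alpha> = 0")
  case True
  have eq: "s * cos \<theta> = pi * sin \<theta>"
    using s N_set_zero_iff[OF R] True by simp
  \<comment> \<open>At this endpoint, which lies outside \<open>W\<close>, the equation would read
    \<open>0 = - pi\<close>.\<close>
  have "\<theta> \<noteq> - pi / 2"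
    using eq by auto
  then have c: "\<bar>\<theta>\<bar> < pi / 2" "cos \<theta> > 0"
    using \<theta> by (auto intro!: cos_gt_zero_pi)
  then have W: "(0, \<theta>) \<in> W"
    by (simp add: W_iff_nonneg)
  then have "S (0, \<theta>) * cos \<theta> = pi * sin \<theta>"
    using S_in_N_set[OF R S W] N_set_zero_iff[OF R] by simp
  with eq c have "s = S (0, \<theta>)"
    by (metis less_irrefl mult_right_cancel)
  then show ?thesis
    using W True by simp
next
  case False
  then have "(\<alpha>, \<theta>) \<in> W \<and> s = S0 (\<alpha>, \<theta>)"
    using N_set_pos[OF R, of \<alpha> \<theta> s] s \<alpha> \<theta> by auto
  then show ?thesis
    using S False \<alpha> by (simp add: is_S_def W0_iff)
qed

theorem theorem3p10:
  fixes R :: "complex \<times> complex \<times> complex \<Rightarrow> complex"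
    and S :: "real \<times> real \<Rightarrow> real"
    and \<alpha> \<theta> :: real
  assumes "is_R R" and "is_S S" and "\<alpha> < 1"
  shows "N_set R \<alpha> \<theta> =
    {s. \<exists>k::int. (\<alpha>, \<theta> + pi * of_int k) \<in> W \<and> s = S (\<alpha>, \<theta> + pi * of_int k)}"
proof (intro set_eqI iffI; clarsimp)
  fix k :: int
  assume "(\<alpha>, \<theta> + pi * of_int k) \<in> W"
  then show "S (\<alpha>, \<theta> + pi * of_int k) \<in> N_set R \<alpha> \<theta>"
    using S_in_N_set[OF assms(1,2) _ assms(3)] N_set_periodic[OF assms(1)] by blast
next
  fix s assume s: "s \<in> N_set R \<alpha> \<theta>"
  show "\<exists>k::int. (\<alpha>, \<theta> + pi * of_int k) \<in> W \<and> s = S (\<alpha>, \<theta> + pi * of_int k)"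
  proof (cases "\<alpha> < 0")
    case True
    then show ?thesis
      using N_set_neg_subset[OF assms(1,2) True s] W_neg by blast
  next
    case False
    obtain k :: int where "- pi / 2 \<le> \<theta> + pi * of_int k" "\<theta> + pi * of_int k < pi / 2"
      using ex_shift_into_strip by blast
    then show ?thesis
      using N_set_nonneg_subset[OF assms(1,2) _ assms(3)] False s N_set_periodic[OF assms(1)]
      by (metis linorder_not_less)
  qed
qed

end
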